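(* Suppose that $F^{A}$ satisfies the global error bound $u_{0}(x)\leq-\kappa\,\theta_{\epsilon}(x)$ for all $x$, with a constant $\kappa>0$ (see context), and that $f_{i}$ is $L_{i}$-smooth for each $i\in[m]$. Let $\{x^{k}\}$ be the sequence generated by the inexact subspace preconditioned proximal Barzilai--Borwein method (described in the context). Then for all $k$, $$u_{0}(x^{k+1})\leq\left(1-\frac{\sigma t_{\min}c\,\alpha_{\min}}{\kappa}\right)u_{0}(x^{k}),$$ where $$c:=\frac{(1-\delta)(1-\epsilon)\alpha_{\min}}{4\alpha_{\max}}\min\left\{\frac{(1-\epsilon)c_{3}\alpha_{\min}}{c_{2}\alpha_{\max}},1\right\},\qquad t_{\min}:=\min\left\{\frac{2\gamma(1-\sigma)(1-\delta)c_{1}\alpha_{\min}}{L_{\max}},1\right\},$$ and $L_{\max}:=\max\{L_i:i\in[m]\}$.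
   Context: Problem: minimize $F^A(x)=(F_1^A(x),\dots,F_m^A(x))$, $F_i^A(x)=f_i(x)+g_i(Ax)$, over $x\in\mathbb{R}^n$, where $A\in\mathbb{R}^{p\times n}$, $f_i:\mathbb{R}^n\to\mathbb{R}$ is continuously differentiable and $g_i:\mathbb{R}^p\to\mathbb{R}\cup\{+\infty\}$ is proper, convex, lower semicontinuous. $\mathrm{dom}F^A=\{x:Ax\in\bigcap_i\mathrm{dom}(g_i)\}$. $[m]=\{1,\dots,m\}$, $\Delta_m$ is the unit simplex in $\mathbb{R}^m$; $\preceq$ between symmetric matrices is the Loewner order. $f_i$ is $L_i$-smooth if $f_i(y)\le f_i(x)+\langle\nabla f_i(x),y-x\rangle+\frac{L_i}{2}\|y-x\|^2$ for all $x,y$. For $w\in\mathbb{R}^m_+$: $f_w=\sum w_if_i$, $g_w=\sum w_ig_i$ (equal to $+\infty$ where some $g_i$ is), $\nabla f_w=\sum w_i\nabla f_i$; $\lambda/\alpha$ is componentwise division; $\|x\|_P=\sqrt{\langle x,Px\rangle}$; $Jf$ is the Jacobian of $f=(f_1,\dots,f_m)$, $g=(g_1,\dots,g_m)$. Error bound. $u_0(x):=\sup_{y\in\mathbb{R}^n}\min_{i\in[m]}\{F_i^A(x)-F_i^A(y)\}$. For $x\in\mathrm{dom}F^A$, a scaling $\tilde\alpha\in[\alpha_{\min},\alpha_{\max}]^m$ and a symmetric matrix $P$ with $c_3I_n\preceq P\preceq c_4I_n$, let for $\lambda\in\Delta_m$ the vector $v(\lambda)$ be the minimizer of $v\mapsto\langle\nabla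 f_{\lambda/\tilde\alpha}(x),v\rangle+g_{\lambda/\tilde\alpha}(Ax+Av)-g_{\lambda/\tilde\alpha}(Ax)+\frac12\|v\|_P^2$; let $\lambda^\epsilon\in\Delta_m$ satisfy, with $w=\lambda^\epsilon/\tilde\alpha$ and $v_\epsilon=v(\lambda^\epsilon)$, $$\max_{i\in[m]}\frac{\langle\nabla f_i(x),v_\epsilon\rangle+g_i(Ax+Av_\epsilon)-g_i(Ax)}{\tilde\alpha_i}\le(1-\epsilon)\left(\langle\nabla f_w(x),v_\epsilon\rangle+g_w(Ax+Av_\epsilon)-g_w(Ax)\right),$$ and set $\theta_\epsilon(x):=\langle\nabla f_w(x),v_\epsilon\rangle+g_w(Ax+Av_\epsilon)-g_w(Ax)+\frac12\|v_\epsilon\|_P^2$. The error bound requires $u_0(x)\le-\kappa\theta_\epsilon(x)$ for all $x$ (in $\mathrm{dom}F^A$, where the quantities are defined) and all such admissible $\tilde\alpha,P,\lambda^\epsilon$. Algorithm. Inputs: $x^0\in\mathrm{dom}F^A$, $\epsilon,\delta\in[0,1)$, $0<c_1\le c_2$, $0<c_3\le c_4$, $\sigma,\gamma\in(0,1)$, $0<\alpha_{\min}\le\alpha_{\max}$. Write $s_{k-1}=x^k-x^{k-1}$, $y_i^{k-1}=\nabla f_i(x^k)-\nabla f_i(x^{k-1})$ (with an auxiliary $x^{-1}$ near $x^0$ for $k=0$). For $k=0,1,2,\dots$: 1. Choose a symmetric $P_k$ with $c_3I_n\preceq P_k\preceq c_4I_n$. For $i\in[m]$ let $\tilde\alpha_i^k=\max\{\alpha_{\min},\min\{\tau,\alpha_{\max}\}\}$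 with $\tau=\langle s_{k-1},y_i^{k-1}\rangle/\|s_{k-1}\|_{P_k}^2$ if $\langle s_{k-1},y_i^{k-1}\rangle>0$, $\tau=\|y_i^{k-1}\|/\|P_ks_{k-1}\|$ if $\langle s_{k-1},y_i^{k-1}\rangle<0$; and $\tilde\alpha_i^k=\alpha_{\min}$ if $\langle s_{k-1},y_i^{k-1}\rangle=0$. 2. For $\lambda\in\Delta_m$ let $x(\lambda)$ be the minimizer over $x$ of $\langle\nabla f_{\lambda/\tilde\alpha^k}(x^k),x-x^k\rangle+g_{\lambda/\tilde\alpha^k}(Ax)-g_{\lambda/\tilde\alpha^k}(Ax^k)+\frac12\|x-x^k\|_{P_k}^2$ and let $\mathcal{D}^k_{PBB}(\lambda)=\max_{i}\frac{\langle\nabla f_i(x^k),x(\lambda)-x^k\rangle+g_i(Ax(\lambda))-g_i(Ax^k)}{\tilde\alpha_i^k}$. Compute $\lambda^{k,\epsilon}_{PBB}\in\Delta_m$ such that, with $v_{k,\epsilon}:=x(\lambda^{k,\epsilon}_{PBB})-x^k$ and $w=\lambda^{k,\epsilon}_{PBB}/\tilde\alpha^k$, $$\mathcal{D}^k_{PBB}(\lambda^{k,\epsilon}_{PBB})\le(1-\epsilon)\left(\langle\nabla f_w(x^k),v_{k,\epsilon}\rangle+g_w(Ax^k+Av_{k,\epsilon})-g_w(Ax^k)\right).$$ If $v_{k,\epsilon}=0$, stop and return $x^k$. 3. If $k=0$: set $d_0=v_{0,\epsilon}$, $\lambda^{0,\epsilon,\delta}=\lambda^{0,\epsilon}_{PBB}$,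 $\alpha^0=\tilde\alpha^0$, and go to step 5. 4. If $k\ge1$: let $u_k$ be the $\|\cdot\|_{P_k}$-projection of $x^k+s_{k-1}$ onto $\bigcap_i\mathrm{dom}(g_i\circ A)$, minus $x^k$. For a vector $v$ let $B_k(v)=\frac1{\epsilon_k}\left(\nabla f_{\lambda^{k-1,\epsilon,\delta}/\alpha^{k-1}}(x^k+\epsilon_kv)-\nabla f_{\lambda^{k-1,\epsilon,\delta}/\alpha^{k-1}}(x^k)\right)$ with $\epsilon_k>0$, and let $q_k(v)=\max\{c_1,\min\{\rho,c_2\}\}$ with $\rho=\langle v,B_k(v)\rangle/\|v\|^2$ if $\langle v,B_k(v)\rangle>0$, $\rho=\|B_k(v)\|/\|v\|$ if $\langle v,B_k(v)\rangle<0$, and $q_k(v)=c_1$ if $\langle v,B_k(v)\rangle=0$. Set $\tilde u_{k,\epsilon}=u_k-\frac{\langle u_k,B_k(v_{k,\epsilon})\rangle}{q_k(v_{k,\epsilon})\|v_{k,\epsilon}\|^2}v_{k,\epsilon}$. Let $\alpha_i^k=\max\{\alpha_{\min},\min\{\tau,\alpha_{\max}\}\}$ with $\tau=\frac{\langle s_{k-1},y_i^{k-1}\rangle}{q_k(s_{k-1})\|s_{k-1}\|^2}$ if $\langle s_{k-1},y_i^{k-1}\rangle>0$, $\tau=\frac{\|y_i^{k-1}\|}{q_k(s_{k-1})\|s_{k-1}\|}$ if $\langle s_{k-1},y_i^{k-1}\rangle<0$, and $\alpha_i^k=\alpha_{\min}$ if $\langle s_{k-1},y_i^{k-1}\rangle=0$.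 For $\lambda\in\Delta_m$ let $z_1(\lambda),z_2(\lambda)\in\mathbb{R}$ be minimizers of $z_1\mapsto\langle\frac{\lambda}{\alpha^k},z_1Jf(x^k)v_{k,\epsilon}+g(Ax^k+z_1Av_{k,\epsilon})\rangle+\frac{q_k(v_{k,\epsilon})}2\|v_{k,\epsilon}\|^2z_1^2$ and $z_2\mapsto\langle\frac{\lambda}{\alpha^k},z_2Jf(x^k)\tilde u_{k,\epsilon}+g(Ax^k+z_2A\tilde u_{k,\epsilon})\rangle+\frac{q_k(\tilde u_{k,\epsilon})}2\|\tilde u_{k,\epsilon}\|^2z_2^2$, and let $$\mathcal{D}^k(\lambda)=\max_i\frac{\langle\nabla f_i(x^k),z_1(\lambda)v_{k,\epsilon}+z_2(\lambda)\tilde u_{k,\epsilon}\rangle+g_i(Ax^k+z_1(\lambda)Av_{k,\epsilon})+g_i(Ax^k+z_2(\lambda)A\tilde u_{k,\epsilon})-2g_i(Ax^k)}{\alpha_i^k}.$$ Compute $\lambda^{k,\epsilon,\delta}\in\Delta_m$ such that, with $z_j=z_j(\lambda^{k,\epsilon,\delta})$, $d_S^{k,\epsilon,\delta}:=z_1v_{k,\epsilon}+z_2\tilde u_{k,\epsilon}$ and $w=\lambda^{k,\epsilon,\delta}/\alpha^k$, $$\mathcal{D}^k(\lambda^{k,\epsilon,\delta})\le(1-\delta)\left(\langle\nabla f_w(x^k),d_S^{k,\epsilon,\delta}\rangle+g_w(Ax^k+z_1Av_{k,\epsilon})+g_w(Ax^k+z_2A\tilde u_{k,\epsilon})-2g_w(Ax^k)\right).$$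 Set $d_k=\frac12d_S^{k,\epsilon,\delta}$. 5. Let $t_k$ be the largest $\gamma^j$, $j\in\{0,1,2,\dots\}$, with $F_i^A(x^k+\gamma^jd_k)-F_i^A(x^k)\le\sigma\gamma^j\left(\langle\nabla f_i(x^k),d_k\rangle+g_i(Ax^k+Ad_k)-g_i(Ax^k)\right)$ for all $i\in[m]$. Set $x^{k+1}=x^k+t_kd_k$. *)

theory Defs
  imports "HOL-Analysis.Analysis"
begin

section \<open>Functions, matrices, weights\<close>

definition grad :: "('a::real_inner \<Rightarrow> real) \<Rightarrow> 'a \<Rightarrow> 'a" where
  "grad f x = (THE D. GDERIV f x :> D)"

definition continuously_differentiable :: "('a::real_inner \<Rightarrow> real) \<Rightarrow> bool" where
  "continuously_differentiable f \<longleftrightarrow>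
     (\<forall>x. f differentiable (at x)) \<and> continuous_on UNIV (grad f)"

definition L_smooth :: "real \<Rightarrow> ('a::real_inner \<Rightarrow> real) \<Rightarrow> bool" where
  "L_smooth L f \<longleftrightarrow> (\<forall>x y. f y \<le> f x + grad f x \<bullet> (y - x) + L / 2 * (norm (y - x))\<^sup>2)"

definition edom :: "('a \<Rightarrow> ereal) \<Rightarrow> 'a set" where
  "edom g = {z. g z < \<infinity>}"

definition proper_fun :: "('a \<Rightarrow> ereal) \<Rightarrow> bool" where
  "proper_fun g \<longleftrightarrow> (\<forall>z. g z \<noteq> -\<infinity>) \<and> edom g \<noteq> {}"

text \<open>For functions that never take the value \<open>-\<infinity>\<close>, no sum below is of the
  form \<open>\<infinity> - \<infinity>\<close>.\<close>
definition convex_fun :: "('a::real_vector \<Rightarrow> ereal) \<Rightarrow> bool" where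
  "convex_fun g \<longleftrightarrow> (\<forall>y z t. 0 < t \<and> t < 1 \<longrightarrow>
     g ((1 - t) *\<^sub>R y + t *\<^sub>R z) \<le> ereal (1 - t) * g y + ereal t * g z)"

definition lsc_fun :: "('a::topological_space \<Rightarrow> ereal) \<Rightarrow> bool" where
  "lsc_fun g \<longleftrightarrow> (\<forall>z. g z \<le> Liminf (at z) g)"

definition loewner_le :: "real^'n^'n \<Rightarrow> real^'n^'n \<Rightarrow> bool" where
  "loewner_le P Q \<longleftrightarrow> (\<forall>v. v \<bullet> (P *v v) \<le> v \<bullet> (Q *v v))"

text \<open>\<open>mat c\<close> is the matrix \<open>c I\<close>.\<close>
definition preconditioner :: "real \<Rightarrow> real \<Rightarrow> real^'n^'n \<Rightarrow> bool" where
  "preconditioner c\<^sub>3 c\<^sub>4 P \<longleftrightarrow>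
     transpose P = P \<and> loewner_le (mat c\<^sub>3) P \<and> loewner_le P (mat c\<^sub>4)"

definition pnorm :: "real^'n^'n \<Rightarrow> real^'n \<Rightarrow> real" where
  "pnorm P x = sqrt (x \<bullet> (P *v x))"

definition unit_simplex :: "(real^'m) set" where
  "unit_simplex = {l. (\<forall>i. 0 \<le> l $ i) \<and> (\<Sum>i\<in>UNIV. l $ i) = 1}"

definition vec_div :: "real^'m \<Rightarrow> real^'m \<Rightarrow> real^'m" where
  "vec_div l a = (\<chi> i. l $ i / a $ i)"

definition clip :: "real \<Rightarrow> real \<Rightarrow> real \<Rightarrow> real" where
  "clip lo hi r = max lo (min r hi)"

text \<open>The safeguarded Barzilai--Borwein rule shared by all scalings of the method:
  \<open>r\<close> is the quotient for positive, \<open>r'\<close> the one for negative curvature \<open>p\<close>.\<close>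
definition bb_rule :: "real \<Rightarrow> real \<Rightarrow> real \<Rightarrow> real \<Rightarrow> real \<Rightarrow> real" where
  "bb_rule lo hi p r r' =
     (if p > 0 then clip lo hi r else if p < 0 then clip lo hi r' else lo)"


section \<open>The composite problem\<close>

context
  fixes f :: "'m::finite \<Rightarrow> real^'n \<Rightarrow> real"
    and g :: "'m \<Rightarrow> real^'p \<Rightarrow> ereal"
    and A :: "real^'n^'p"
begin

definition comp_obj :: "'m \<Rightarrow> real^'n \<Rightarrow> ereal" where
  "comp_obj i x = ereal (f i x) + g i (A *v x)"

definition comp_dom :: "(real^'n) set" where
  "comp_dom = {x. A *v x \<in> (\<Inter>i. edom (g i))}"

definition merit :: "real^'n \<Rightarrow> ereal" where
  "merit x = (SUP y. MIN i. comp_obj i x - comp_obj i y)"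

definition wgrad :: "real^'m \<Rightarrow> real^'n \<Rightarrow> real^'n" where
  "wgrad w x = (\<Sum>i\<in>UNIV. (w $ i) *\<^sub>R grad (f i) x)"

text \<open>The case distinction is needed because \<open>0 * \<infinity> = 0\<close> in \<open>ereal\<close>, whereas the
  weighted sum is \<open>\<infinity>\<close> wherever some \<open>g i\<close> is, also if the weight of \<open>g i\<close> is zero.\<close>
definition wsum :: "real^'m \<Rightarrow> real^'p \<Rightarrow> ereal" where
  "wsum w z = (if \<exists>i. g i z = \<infinity> then \<infinity> else (\<Sum>i\<in>UNIV. ereal (w $ i) * g i z))"

definition model :: "'m \<Rightarrow> real^'n \<Rightarrow> real^'n \<Rightarrow> ereal" where
  "model i x v = ereal (grad (f i) x \<bullet> v) + g i (A *v x + A *v v) - g i (A *v x)"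

definition wmodel :: "real^'m \<Rightarrow> real^'n \<Rightarrow> real^'n \<Rightarrow> ereal" where
  "wmodel w x v = ereal (wgrad w x \<bullet> v) + wsum w (A *v x + A *v v) - wsum w (A *v x)"

definition prox_obj :: "real^'m \<Rightarrow> real^'n^'n \<Rightarrow> real^'n \<Rightarrow> real^'n \<Rightarrow> ereal" where
  "prox_obj w P x v = wmodel w x v + ereal (1 / 2 * (pnorm P v)\<^sup>2)"

text \<open>\<open>l\<close> is an \<open>\<epsilon>\<close>-inexact dual solution at \<open>x\<close>, with \<open>v = v(l)\<close> the corresponding
  minimizer.  In the algorithm \<open>v = x(l) - x\<close>, where \<open>x(l)\<close> minimizes the same function
  after the substitution \<open>v = y - x\<close>.\<close>
definition inexact_pbb ::
  "real \<Rightarrow> real^'m \<Rightarrow> real^'n^'n \<Rightarrow> real^'n \<Rightarrow> real^'m \<Rightarrow> real^'n \<Rightarrow> bool" where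
  "inexact_pbb \<epsilon> a P x l v \<longleftrightarrow>
     l \<in> unit_simplex \<and>
     is_arg_min (prox_obj (vec_div l a) P x) (\<lambda>_. True) v \<and>
     (MAX i. model i x v / ereal (a $ i)) \<le> ereal (1 - \<epsilon>) * wmodel (vec_div l a) x v"

text \<open>On the right-hand side, \<open>prox_obj (vec_div l a) P x v\<close> is \<open>\<theta>\<^sub>\<epsilon>(x)\<close>.\<close>
definition error_bound :: "real \<Rightarrow> real \<Rightarrow> real \<Rightarrow> real \<Rightarrow> real \<Rightarrow> real \<Rightarrow> bool" where
  "error_bound \<epsilon> c\<^sub>3 c\<^sub>4 \<alpha>\<^sub>m\<^sub>i\<^sub>n \<alpha>\<^sub>m\<^sub>a\<^sub>x \<kappa> \<longleftrightarrow>
     (\<forall>x\<in>comp_dom. \<forall>a P l v.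
        (\<forall>i. a $ i \<in> {\<alpha>\<^sub>m\<^sub>i\<^sub>n..\<alpha>\<^sub>m\<^sub>a\<^sub>x}) \<and> preconditioner c\<^sub>3 c\<^sub>4 P \<and> inexact_pbb \<epsilon> a P x l v \<longrightarrow>
        merit x \<le> - (ereal \<kappa> * prox_obj (vec_div l a) P x v))"


section \<open>The inexact subspace preconditioned proximal Barzilai--Borwein method\<close>

subsection \<open>Preconditioned proximal direction\<close>

definition precond_scaling ::
  "real \<Rightarrow> real \<Rightarrow> real^'n^'n \<Rightarrow> real^'n \<Rightarrow> real^'n \<Rightarrow> real^'m" where
  "precond_scaling \<alpha>\<^sub>m\<^sub>i\<^sub>n \<alpha>\<^sub>m\<^sub>a\<^sub>x P x' x = (\<chi> i.
     let s = x - x'; y = grad (f i) x - grad (f i) x'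
     in bb_rule \<alpha>\<^sub>m\<^sub>i\<^sub>n \<alpha>\<^sub>m\<^sub>a\<^sub>x (s \<bullet> y) (s \<bullet> y / (pnorm P s)\<^sup>2) (norm y / norm (P *v s)))"

subsection \<open>Subspace step\<close>

text \<open>\<open>w\<close> is the weight \<open>\<lambda>/\<alpha>\<close> of the previous iteration, \<open>h > 0\<close> the difference step.\<close>
definition hess_vec :: "real^'m \<Rightarrow> real \<Rightarrow> real^'n \<Rightarrow> real^'n \<Rightarrow> real^'n" where
  "hess_vec w h x v = (1 / h) *\<^sub>R (wgrad w (x + h *\<^sub>R v) - wgrad w x)"

definition curv ::
  "real \<Rightarrow> real \<Rightarrow> real^'m \<Rightarrow> real \<Rightarrow> real^'n \<Rightarrow> real^'n \<Rightarrow> real" where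
  "curv c\<^sub>1 c\<^sub>2 w h x v =
     (let b = hess_vec w h x v
      in bb_rule c\<^sub>1 c\<^sub>2 (v \<bullet> b) (v \<bullet> b / (norm v)\<^sup>2) (norm b / norm v))"

definition subspace_scaling ::
  "real \<Rightarrow> real \<Rightarrow> (real^'n \<Rightarrow> real) \<Rightarrow> real^'n \<Rightarrow> real^'n \<Rightarrow> real^'m" where
  "subspace_scaling \<alpha>\<^sub>m\<^sub>i\<^sub>n \<alpha>\<^sub>m\<^sub>a\<^sub>x q x' x = (\<chi> i.
     let s = x - x'; y = grad (f i) x - grad (f i) x'
     in bb_rule \<alpha>\<^sub>m\<^sub>i\<^sub>n \<alpha>\<^sub>m\<^sub>a\<^sub>x (s \<bullet> y) (s \<bullet> y / (q s * (norm s)\<^sup>2)) (norm y / (q s * norm s)))"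

definition line_obj ::
  "real^'m \<Rightarrow> (real^'n \<Rightarrow> real) \<Rightarrow> real^'n \<Rightarrow> real^'n \<Rightarrow> real \<Rightarrow> ereal" where
  "line_obj w q x v z =
     ereal (w \<bullet> (z *\<^sub>R (jacobian (\<lambda>y. \<chi> i. f i y) (at x) *v v)))
     + wsum w (A *v x + z *\<^sub>R (A *v v))
     + ereal (q v / 2 * (norm v)\<^sup>2 * z\<^sup>2)"

text \<open>\<open>l\<close> is a \<open>\<delta>\<close>-inexact dual solution of the decoupled problem on the span of \<open>v\<close>
  and \<open>u\<close>, with \<open>z\<^sub>1\<close>, \<open>z\<^sub>2\<close> the values at \<open>l\<close> of the minimizer maps.\<close>
definition inexact_subspace ::
  "real \<Rightarrow> (real^'n \<Rightarrow> real) \<Rightarrow> real^'m \<Rightarrow> real^'n \<Rightarrow> real^'n \<Rightarrow> real^'n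
     \<Rightarrow> real^'m \<Rightarrow> real \<Rightarrow> real \<Rightarrow> bool" where
  "inexact_subspace \<delta> q a x v u l z\<^sub>1 z\<^sub>2 \<longleftrightarrow>
     l \<in> unit_simplex \<and>
     is_arg_min (line_obj (vec_div l a) q x v) (\<lambda>_. True) z\<^sub>1 \<and>
     is_arg_min (line_obj (vec_div l a) q x u) (\<lambda>_. True) z\<^sub>2 \<and>
     (let w = vec_div l a; d = z\<^sub>1 *\<^sub>R v + z\<^sub>2 *\<^sub>R u;
          p\<^sub>1 = A *v x + z\<^sub>1 *\<^sub>R (A *v v); p\<^sub>2 = A *v x + z\<^sub>2 *\<^sub>R (A *v u)
      in (MAX i. (ereal (grad (f i) x \<bullet> d) + g i p\<^sub>1 + g i p\<^sub>2 - 2 * g i (A *v x))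
                   / ereal (a $ i))
         \<le> ereal (1 - \<delta>)
            * (ereal (wgrad w x \<bullet> d) + wsum w p\<^sub>1 + wsum w p\<^sub>2 - 2 * wsum w (A *v x)))"

text \<open>Here \<open>x'\<close>, \<open>x\<close> are the previous and the current iterate, \<open>w\<close> is the previous weight,
  \<open>v\<close> the preconditioned proximal direction; \<open>l\<close>, \<open>a\<close>, \<open>d\<close> are the resulting multiplier,
  scaling and search direction.  The projection may fail to exist (the domain need not be
  closed); it is then impossible to perform the step.\<close>
definition subspace_step ::
  "real \<Rightarrow> real \<Rightarrow> real \<Rightarrow> real \<Rightarrow> real \<Rightarrow> real^'n^'n \<Rightarrow> real^'m \<Rightarrow> real^'n \<Rightarrow> real^'n \<Rightarrow> real^'n
     \<Rightarrow> real^'m \<Rightarrow> real^'m \<Rightarrow> real^'n \<Rightarrow> bool" where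
  "subspace_step \<delta> c\<^sub>1 c\<^sub>2 \<alpha>\<^sub>m\<^sub>i\<^sub>n \<alpha>\<^sub>m\<^sub>a\<^sub>x P w x' x v l a d \<longleftrightarrow>
     (\<exists>h u z\<^sub>1 z\<^sub>2. h > 0 \<and>
        is_arg_min (\<lambda>y. pnorm P (y - (x + (x - x')))) (\<lambda>y. y \<in> comp_dom) (x + u) \<and>
        (let q = curv c\<^sub>1 c\<^sub>2 w h x;
             u' = u - (u \<bullet> hess_vec w h x v / (q v * (norm v)\<^sup>2)) *\<^sub>R v
         in a = subspace_scaling \<alpha>\<^sub>m\<^sub>i\<^sub>n \<alpha>\<^sub>m\<^sub>a\<^sub>x q x' x \<and>
            inexact_subspace \<delta> q a x v u' l z\<^sub>1 z\<^sub>2 \<and>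
            d = (1 / 2) *\<^sub>R (z\<^sub>1 *\<^sub>R v + z\<^sub>2 *\<^sub>R u')))"

subsection \<open>Line search and iteration\<close>

definition step_sizes :: "real \<Rightarrow> real \<Rightarrow> real^'n \<Rightarrow> real^'n \<Rightarrow> real set" where
  "step_sizes \<sigma> \<gamma> x d = {\<gamma> ^ j |j. \<forall>i.
     comp_obj i (x + \<gamma> ^ j *\<^sub>R d) - comp_obj i x \<le> ereal (\<sigma> * \<gamma> ^ j) * model i x d}"

definition line_search :: "real \<Rightarrow> real \<Rightarrow> real^'n \<Rightarrow> real^'n \<Rightarrow> real \<Rightarrow> bool" where
  "line_search \<sigma> \<gamma> x d t \<longleftrightarrow> t \<in> step_sizes \<sigma> \<gamma> x d \<and> (\<forall>s\<in>step_sizes \<sigma> \<gamma> x d. s \<le> t)"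

text \<open>\<open>x 0, \<dots>, x N\<close> (all \<open>x k\<close> if \<open>N = \<infinity>\<close>) are iterates of the method, that is, the
  iterations \<open>k < N\<close> have been carried out without meeting the stopping criterion
  \<open>v k = 0\<close>; later members of the sequence \<open>x\<close> are irrelevant.  Since \<open>N\<close> is arbitrary,
  this covers infinite runs as well as runs that stop.  \<open>x\<^sub>_\<^sub>1\<close> is the auxiliary
  point preceding \<open>x 0\<close>.\<close>
definition ispbb_run ::
  "real \<Rightarrow> real \<Rightarrow> real \<Rightarrow> real \<Rightarrow> real \<Rightarrow> real \<Rightarrow> real \<Rightarrow> real \<Rightarrow> real \<Rightarrow> real
     \<Rightarrow> enat \<Rightarrow> real^'n \<Rightarrow> (nat \<Rightarrow> real^'n) \<Rightarrow> bool" where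
  "ispbb_run \<epsilon> \<delta> c\<^sub>1 c\<^sub>2 c\<^sub>3 c\<^sub>4 \<sigma> \<gamma> \<alpha>\<^sub>m\<^sub>i\<^sub>n \<alpha>\<^sub>m\<^sub>a\<^sub>x N x\<^sub>_\<^sub>1 x \<longleftrightarrow>
     x 0 \<in> comp_dom \<and>
     (\<exists>P a' l' v a l d t. \<forall>k. enat k < N \<longrightarrow>
        (let xprev = (if k = 0 then x\<^sub>_\<^sub>1 else x (k - 1))
         in preconditioner c\<^sub>3 c\<^sub>4 (P k) \<and>
            a' k = precond_scaling \<alpha>\<^sub>m\<^sub>i\<^sub>n \<alpha>\<^sub>m\<^sub>a\<^sub>x (P k) xprev (x k) \<and>
            inexact_pbb \<epsilon> (a' k) (P k) (x k) (l' k) (v k) \<and>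
            v k \<noteq> 0 \<and>
            (if k = 0 then d 0 = v 0 \<and> l 0 = l' 0 \<and> a 0 = a' 0
             else subspace_step \<delta> c\<^sub>1 c\<^sub>2 \<alpha>\<^sub>m\<^sub>i\<^sub>n \<alpha>\<^sub>m\<^sub>a\<^sub>x (P k) (vec_div (l (k - 1)) (a (k - 1)))
                    xprev (x k) (v k) (l k) (a k) (d k)) \<and>
            line_search \<sigma> \<gamma> (x k) (d k) (t k) \<and>
            x (Suc k) = x k + t k *\<^sub>R d k))"

end

end

theory Submission
  imports Defs
begin

text \<open>
  Fix an iterate \<open>x\<close> with preconditioned direction \<open>v\<close>, and let \<open>W\<close> be the weighted
  first-order model \<open>\<langle>\<nabla>f\<^sub>w(x), v\<rangle> + g\<^sub>w(Ax + Av) - g\<^sub>w(Ax)\<close>, a nonpositive number.  It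
  measures progress in two ways.  Since \<open>W\<close> is at most the optimal value \<open>\<theta>\<^sub>\<epsilon>(x)\<close>, the error
  bound gives \<open>u\<^sub>0(x) \<le> -\<kappa> W\<close>.  And the search direction \<open>d\<close> has, for every \<open>i\<close>, a model
  decrease of at least \<open>\<alpha>\<^sub>m\<^sub>i\<^sub>n C \<bar>W\<bar>\<close>, with a constant \<open>C\<close> depending on the kind of step.  If
  the line search accepts \<open>t\<close>, every \<open>F\<^sub>i\<close> drops by at least
  \<open>\<sigma> t \<alpha>\<^sub>m\<^sub>i\<^sub>n C \<bar>W\<bar> \<ge> (\<sigma> t C \<alpha>\<^sub>m\<^sub>i\<^sub>n / \<kappa>) u\<^sub>0(x)\<close>.  A common decrease of all \<open>F\<^sub>i\<close> passes through
  the minimum and the supremum that define \<open>u\<^sub>0\<close>, so \<open>u\<^sub>0\<close> contracts by the factor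
  \<open>1 - \<sigma> t C \<alpha>\<^sub>m\<^sub>i\<^sub>n / \<kappa>\<close> (\<open>merit_contraction\<close>).  It remains to show \<open>t C \<ge> t\<^sub>m\<^sub>i\<^sub>n c\<close>.

  For \<open>k \<ge> 1\<close>, \<open>C = c\<close> and \<open>t \<ge> t\<^sub>m\<^sub>i\<^sub>n\<close>.  The subspace problem minimizes over multiples of \<open>v\<close>,
  so its optimal value can be compared with the one at \<open>\<mu> v\<close>; the best admissible
  \<open>\<mu> \<in> [0,1]\<close> yields \<open>c\<close> (\<open>subspace_direction\<close>).  The optimal coefficients also give
  a decrease proportional to \<open>\<parallel>d\<parallel>\<^sup>2\<close>, from which smoothness of the \<open>f\<^sub>i\<close> bounds \<open>t\<close> below
  (\<open>line_search_ge\<close>).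

  For \<open>k = 0\<close> the direction is \<open>v\<close> itself.  Then \<open>C = 1 - \<epsilon>\<close>, which is larger than
  \<open>c\<close>, whereas the lower bound for \<open>t\<close> involves \<open>(1 - \<epsilon>) c\<^sub>3\<close> in place of
  \<open>(1 - \<delta>) c\<^sub>1\<close> and may be smaller than \<open>t\<^sub>m\<^sub>i\<^sub>n\<close>.  The quotient \<open>c\<^sub>3 / c\<^sub>2\<close> in \<open>c\<close> and
  \<open>c\<^sub>1 \<le> c\<^sub>2\<close> make up for the difference (\<open>initial_rate\<close>).
\<close>

section \<open>Real-valued models on the effective domain\<close>

lemma inner_left_unique: "(\<lambda>h. h \<bullet> a) = (\<lambda>h. h \<bullet> b) \<Longrightarrow> a = b"
  by (metis inner_commute vector_eq_rdot)

text \<open>In finite dimensions the derivative is represented by a vector, the adjoint of the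
  derivative applied to \<open>1\<close>; uniqueness of derivatives identifies it with \<open>grad f x\<close>.\<close>
lemma GDERIV_grad:
  fixes f :: "'a::euclidean_space \<Rightarrow> real"
  assumes "f differentiable (at x)"
  shows "GDERIV f x :> grad f x"
proof -
  obtain f' where f': "(f has_derivative f') (at x)"
    using assms by (auto simp: differentiable_def)
  then have "linear f'"
    by (rule has_derivative_linear)
  then have "f' = (\<lambda>h. h \<bullet> adjoint f' 1)"
    by (simp add: adjoint_works)
  with f' have "GDERIV f x :> adjoint f' 1"
    by (simp add: gderiv_def)
  then show ?thesis
    unfolding grad_def
    by (metis (mono_tags, lifting) has_derivative_unique gderiv_def inner_left_unique theI)
qed

lemma jacobian_vec_lambda:
  fixes f :: "'m::finite \<Rightarrow> real^'n \<Rightarrow> real"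
  assumes "\<And>i. f i differentiable (at x)"
  shows "jacobian (\<lambda>y. \<chi> i. f i y) (at x) *v v = (\<chi> i. grad (f i) x \<bullet> v)"
proof -
  have "((\<lambda>y. \<chi> i. f i y) has_derivative (\<lambda>h. \<chi> i. grad (f i) x \<bullet> h)) (at x)"
    using GDERIV_grad[OF assms]
    by (subst has_derivative_componentwise_within)
      (auto simp: gderiv_def Basis_vec_def inner_axis' inner_commute)
  moreover from this have "(\<lambda>y. \<chi> i. f i y) differentiable (at x)"
    by (auto simp: differentiable_def)
  ultimately show ?thesis
    by (metis jacobian_works has_derivative_unique)
qed

lemma unit_simplex_sum_le:
  assumes "l \<in> unit_simplex" "\<And>i. r i \<le> b"
  shows "(\<Sum>i\<in>UNIV. l $ i * r i) \<le> b"
proof -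
  have "(\<Sum>i\<in>UNIV. l $ i * r i) \<le> (\<Sum>i\<in>UNIV. l $ i * b)"
    using assms by (intro sum_mono mult_left_mono) (auto simp: unit_simplex_def)
  also have "\<dots> = b"
    using assms by (simp add: unit_simplex_def flip: sum_distrib_right)
  finally show ?thesis .
qed

lemma bb_rule_bounds: "lo \<le> hi \<Longrightarrow> lo \<le> bb_rule lo hi p r r' \<and> bb_rule lo hi p r r' \<le> hi"
  by (auto simp: bb_rule_def clip_def)

locale convex_composite =
  fixes f :: "'m::finite \<Rightarrow> real^'n \<Rightarrow> real"
    and g :: "'m \<Rightarrow> real^'p \<Rightarrow> ereal"
    and A :: "real^'n^'p"
  assumes proper: "\<And>i. proper_fun (g i)"
    and convex: "\<And>i. convex_fun (g i)"
begin

text \<open>All arithmetic is done with real numbers: on the effective domain the values of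
  \<open>g i (A *v x)\<close> are finite, and \<open>G\<close>, \<open>rmodel\<close>, \<open>rwmodel\<close> are the real versions of
  \<open>g \<circ> A\<close>, \<open>model\<close> and \<open>wmodel\<close> there.  Off the domain they carry no information.\<close>
definition G :: "'m \<Rightarrow> real^'n \<Rightarrow> real" where
  "G i x = real_of_ereal (g i (A *v x))"

definition rmodel :: "'m \<Rightarrow> real^'n \<Rightarrow> real^'n \<Rightarrow> real" where
  "rmodel i x v = grad (f i) x \<bullet> v + G i (x + v) - G i x"

definition rwmodel :: "real^'m \<Rightarrow> real^'n \<Rightarrow> real^'n \<Rightarrow> real" where
  "rwmodel w x v = (\<Sum>i\<in>UNIV. w $ i * rmodel i x v)"

lemma comp_dom_iff: "x \<in> comp_dom g A \<longleftrightarrow> (\<forall>i. g i (A *v x) \<noteq> \<infinity>)"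
  by (simp add: comp_dom_def edom_def less_top)

lemma g_eq_G: "x \<in> comp_dom g A \<Longrightarrow> g i (A *v x) = ereal (G i x)"
  using proper[of i] unfolding G_def comp_dom_iff proper_fun_def by (cases "g i (A *v x)") auto

lemma G_convex:
  assumes "x \<in> comp_dom g A" "y \<in> comp_dom g A" "0 < t" "t < 1"
  shows "(1 - t) *\<^sub>R x + t *\<^sub>R y \<in> comp_dom g A"
    and "G i ((1 - t) *\<^sub>R x + t *\<^sub>R y) \<le> (1 - t) * G i x + t * G i y"
proof -
  let ?z = "(1 - t) *\<^sub>R x + t *\<^sub>R y"
  have le: "g i (A *v ?z) \<le> ereal ((1 - t) * G i x + t * G i y)" for i
    using convex[of i] assms g_eq_G[OF assms(1), of i] g_eq_G[OF assms(2), of i]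
    unfolding convex_fun_def
    by (metis matrix_vector_right_distrib matrix_vector_mult_scaleR times_ereal.simps(1)
        plus_ereal.simps(1))
  then show dom: "?z \<in> comp_dom g A"
    unfolding comp_dom_iff by (metis ereal_infty_less_eq(1) PInfty_neq_ereal(1))
  show "G i ?z \<le> (1 - t) * G i x + t * G i y"
    using le[of i] g_eq_G[OF dom, of i] by simp
qed

text \<open>The model is convex in the direction and vanishes at the zero direction.\<close>
lemma rmodel_scaleR_le:
  assumes "x \<in> comp_dom g A" "x + v \<in> comp_dom g A" "0 \<le> t" "t \<le> 1"
  shows "x + t *\<^sub>R v \<in> comp_dom g A" and "rmodel i x (t *\<^sub>R v) \<le> t * rmodel i x v"
proof -
  have *: "x + t *\<^sub>R v \<in> comp_dom g A \<and> rmodel i x (t *\<^sub>R v) \<le> t * rmodel i x v" for i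
  proof (cases "t = 0 \<or> t = 1")
    case True
    then show ?thesis using assms by (auto simp: rmodel_def)
  next
    case False
    have eq: "(1 - t) *\<^sub>R x + t *\<^sub>R (x + v) = x + t *\<^sub>R v"
      by (simp add: algebra_simps)
    show ?thesis
      using G_convex(1)[OF assms(1,2), of t] G_convex(2)[OF assms(1,2), of t i] False assms(3,4) unfolding eq
      by (simp add: rmodel_def algebra_simps)
  qed
  then show "x + t *\<^sub>R v \<in> comp_dom g A" "rmodel i x (t *\<^sub>R v) \<le> t * rmodel i x v"
    by auto
qed

lemma rmodel_midpoint_le:
  assumes "x + u \<in> comp_dom g A" "x + v \<in> comp_dom g A"
  shows "x + (1 / 2) *\<^sub>R (u + v) \<in> comp_dom g A"
    and "rmodel i x ((1 / 2) *\<^sub>R (u + v)) \<le> (rmodel i x u + rmodel i x v) / 2"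
proof -
  have eq: "(1 - 1 / 2) *\<^sub>R (x + u) + (1 / 2) *\<^sub>R (x + v) = x + (1 / 2) *\<^sub>R (u + v)"
    by (simp add: algebra_simps flip: scaleR_add_left)
  show "x + (1 / 2) *\<^sub>R (u + v) \<in> comp_dom g A"
    using G_convex(1)[OF assms, of "1/2"] unfolding eq by simp
  show "rmodel i x ((1 / 2) *\<^sub>R (u + v)) \<le> (rmodel i x u + rmodel i x v) / 2"
    using G_convex(2)[OF assms, of "1/2" i] unfolding eq
    by (simp add: rmodel_def inner_add_right field_simps)
qed

lemma model_eq_rmodel:
  assumes "x \<in> comp_dom g A" "x + v \<in> comp_dom g A"
  shows "model f g A i x v = ereal (rmodel i x v)"
  using g_eq_G[OF assms(1), of i] g_eq_G[OF assms(2), of i]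
  by (simp add: model_def rmodel_def flip: matrix_vector_right_distrib)

lemma wsum_eq:
  assumes "x \<in> comp_dom g A"
  shows "wsum g w (A *v x) = ereal (\<Sum>i\<in>UNIV. w $ i * G i x)"
  using g_eq_G[OF assms] by (simp add: wsum_def)

lemma rwmodel_eq:
  "rwmodel w x v
    = wgrad f w x \<bullet> v + (\<Sum>i\<in>UNIV. w $ i * G i (x + v)) - (\<Sum>i\<in>UNIV. w $ i * G i x)"
  by (simp add: rwmodel_def rmodel_def wgrad_def inner_sum_left algebra_simps sum.distrib
      sum_subtractf)

lemma wmodel_eq_rwmodel:
  assumes "x \<in> comp_dom g A" "x + v \<in> comp_dom g A"
  shows "wmodel f g A w x v = ereal (rwmodel w x v)"
  using wsum_eq[OF assms(1)] wsum_eq[OF assms(2)]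
  by (simp add: wmodel_def rwmodel_eq flip: matrix_vector_right_distrib)

text \<open>This is what forces minimizers to stay in the effective domain.\<close>
lemma wmodel_infinite:
  assumes "x \<in> comp_dom g A" "x + v \<notin> comp_dom g A"
  shows "wmodel f g A w x v = \<infinity>"
  using wsum_eq[OF assms(1)] assms(2) unfolding wmodel_def comp_dom_iff
  by (simp add: wsum_def flip: matrix_vector_right_distrib)

lemma rwmodel_scaleR_le:
  assumes "x \<in> comp_dom g A" "x + v \<in> comp_dom g A" "0 \<le> t" "t \<le> 1" "\<And>i. 0 \<le> w $ i"
  shows "rwmodel w x (t *\<^sub>R v) \<le> t * rwmodel w x v"
proof -
  have "rwmodel w x (t *\<^sub>R v) \<le> (\<Sum>i\<in>UNIV. w $ i * (t * rmodel i x v))"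
    unfolding rwmodel_def using assms by (intro sum_mono mult_left_mono rmodel_scaleR_le) auto
  then show ?thesis
    by (simp add: rwmodel_def sum_distrib_left mult_ac)
qed

section \<open>Proximal steps\<close>

text \<open>Minimality of a convex function plus a quadratic, tested on the segment from \<open>0\<close> to
  the minimizer only.  With \<open>m = rwmodel w x v\<close>, convexity bounds the model at \<open>t v\<close> by
  \<open>t m\<close>, so \<open>m + Q \<le> t m + t\<^sup>2 Q\<close>, that is, \<open>m \<le> -(1 + t) Q\<close> for \<open>t < 1\<close>.  Letting
  \<open>t \<rightarrow> 1\<close> gains the factor \<open>2\<close> over the comparison with \<open>t = 0\<close>.  The formulation along
  a segment serves both the preconditioned problem and the two line problems.\<close>
lemma proximal_step:
  assumes x: "x \<in> comp_dom g A" and w: "\<And>i. 0 \<le> w $ i"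
    and min: "\<And>t. 0 \<le> t \<Longrightarrow> t \<le> 1 \<Longrightarrow>
      wmodel f g A w x v + ereal Q \<le> wmodel f g A w x (t *\<^sub>R v) + ereal (t\<^sup>2 * Q)"
  shows "x + v \<in> comp_dom g A" and "rwmodel w x v \<le> - 2 * Q"
proof -
  show dom: "x + v \<in> comp_dom g A"
  proof (rule ccontr)
    assume "x + v \<notin> comp_dom g A"
    then show False
      using min[of 0] wmodel_infinite[OF x] wmodel_eq_rwmodel[OF x, of 0] x by simp
  qed
  show "rwmodel w x v \<le> - 2 * Q"
    \<comment> \<open>Division by \<open>1 - t\<close> excludes \<open>t = 1\<close> itself, hence the limit.\<close>
  proof (rule tendsto_lowerbound)
    show "((\<lambda>t. - (1 + t) * Q) \<longlongrightarrow> - 2 * Q) (at_left 1)"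
      by (auto intro!: tendsto_eq_intros)
    show "\<forall>\<^sub>F t in at_left 1. rwmodel w x v \<le> - (1 + t) * Q"
      using eventually_at_left_real[of 0 1]
    proof (rule eventually_mono)
      fix t :: real assume "t \<in> {0<..<1}"
      then have t: "0 < t" "t < 1" by auto
      have "rwmodel w x v + Q \<le> rwmodel w x (t *\<^sub>R v) + t\<^sup>2 * Q"
        using min[of t] t wmodel_eq_rwmodel[OF x dom]
          wmodel_eq_rwmodel[OF x rmodel_scaleR_le(1)[OF x dom, of t]] by simp
      then have "(1 - t) * rwmodel w x v \<le> (1 - t) * (- (1 + t) * Q)"
        using rwmodel_scaleR_le[OF x dom _ _ w, of t] t
        by (simp add: algebra_simps power2_eq_square)
      then show "rwmodel w x v \<le> - (1 + t) * Q"
        using t by simp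
    qed simp
  qed simp
qed

lemma pnorm_scaleR_sq: "(pnorm P (t *\<^sub>R v))\<^sup>2 = t\<^sup>2 * (pnorm P v)\<^sup>2"
  by (simp add: pnorm_def real_sqrt_mult matrix_vector_mult_scaleR power_mult_distrib
      flip: mult.assoc power2_eq_square)

lemma preconditioner_pnorm_ge:
  assumes "preconditioner c3 c4 P" "0 \<le> c3"
  shows "c3 * (norm v)\<^sup>2 \<le> (pnorm P v)\<^sup>2"
proof -
  have "mat c3 *v v = c3 *\<^sub>R v"
    by (simp add: vec_eq_iff mat_def matrix_vector_mult_def if_distribR if_distrib[of "\<lambda>c. c * _"] cong: if_cong)
  then have "c3 * (norm v)\<^sup>2 \<le> v \<bullet> (P *v v)"
    using assms unfolding preconditioner_def loewner_le_def power2_norm_eq_inner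
    by (metis inner_scaleR_right)
  moreover have "0 \<le> c3 * (norm v)\<^sup>2"
    using assms by simp
  ultimately show ?thesis
    by (simp add: pnorm_def)
qed

text \<open>The inexactness criterion transfers the decrease of the weighted model to every single
  component: the maximum over \<open>i\<close> on its left-hand side dominates each scaled model.\<close>
lemma inexact_pbb_step:
  assumes x: "x \<in> comp_dom g A" and a: "\<And>i. 0 < a $ i"
    and step: "inexact_pbb f g A \<epsilon> a P x l v"
  defines "w \<equiv> vec_div l a"
  shows "x + v \<in> comp_dom g A"
    and "rwmodel w x v \<le> - (pnorm P v)\<^sup>2"
    and "rmodel i x v \<le> a $ i * ((1 - \<epsilon>) * rwmodel w x v)"
    and "prox_obj f g A w P x v = ereal (rwmodel w x v + (pnorm P v)\<^sup>2 / 2)"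
proof -
  have w: "0 \<le> w $ i" for i
    using step a[of i] by (simp add: inexact_pbb_def w_def vec_div_def unit_simplex_def)
  have "prox_obj f g A w P x v \<le> prox_obj f g A w P x (t *\<^sub>R v)" for t
    using step by (auto simp: inexact_pbb_def is_arg_min_linorder w_def)
  then have *: "wmodel f g A w x v + ereal ((pnorm P v)\<^sup>2 / 2)
      \<le> wmodel f g A w x (t *\<^sub>R v) + ereal (t\<^sup>2 * ((pnorm P v)\<^sup>2 / 2))" for t
    by (simp add: prox_obj_def pnorm_scaleR_sq)
  show dom: "x + v \<in> comp_dom g A"
    by (rule proximal_step(1)[OF x w *])
  show "rwmodel w x v \<le> - (pnorm P v)\<^sup>2"
    using proximal_step(2)[OF x w *] by simp
  show "prox_obj f g A w P x v = ereal (rwmodel w x v + (pnorm P v)\<^sup>2 / 2)"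
    by (simp add: prox_obj_def wmodel_eq_rwmodel[OF x dom])
  have "model f g A i x v / ereal (a $ i) \<le> (MAX i. model f g A i x v / ereal (a $ i))"
    by (intro Max_ge) auto
  also have "\<dots> \<le> ereal (1 - \<epsilon>) * wmodel f g A w x v"
    using step by (simp add: inexact_pbb_def w_def)
  finally show "rmodel i x v \<le> a $ i * ((1 - \<epsilon>) * rwmodel w x v)"
    using a[of i] by (simp add: model_eq_rmodel[OF x dom] wmodel_eq_rwmodel[OF x dom] field_simps)
qed

text \<open>The objective along a line is the weighted model restricted to that line, up to a
  constant and the quadratic term; hence minimizers are proximal steps.\<close>
lemma line_obj_eq:
  assumes x: "x \<in> comp_dom g A" and diff: "\<And>i. f i differentiable (at x)"
  shows "line_obj f g A w q x v z
    = wmodel f g A w x (z *\<^sub>R v) + ereal ((\<Sum>i\<in>UNIV. w $ i * G i x) + z\<^sup>2 * (q v / 2 * (norm v)\<^sup>2))"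
proof -
  have "w \<bullet> (z *\<^sub>R (jacobian (\<lambda>y. \<chi> i. f i y) (at x) *v v)) = wgrad f w x \<bullet> (z *\<^sub>R v)"
    unfolding jacobian_vec_lambda[OF diff] wgrad_def inner_sum_left
    by (simp add: inner_vec_def[of w] sum_distrib_left mult_ac)
  then show ?thesis
    unfolding line_obj_def wmodel_def wsum_eq[OF x] matrix_vector_mult_scaleR
    by (cases "wsum g w (A *v x + z *\<^sub>R (A *v v))") (simp_all add: algebra_simps)
qed

lemma line_min:
  assumes x: "x \<in> comp_dom g A" and diff: "\<And>i. f i differentiable (at x)"
    and w: "\<And>i. 0 \<le> w $ i"
    and min: "is_arg_min (line_obj f g A w q x v) (\<lambda>_. True) z"
  shows "x + z *\<^sub>R v \<in> comp_dom g A"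
    and "rwmodel w x (z *\<^sub>R v) \<le> - q v * (norm (z *\<^sub>R v))\<^sup>2"
    and "x + y *\<^sub>R v \<in> comp_dom g A \<Longrightarrow>
      rwmodel w x (z *\<^sub>R v) + q v / 2 * (norm (z *\<^sub>R v))\<^sup>2
        \<le> rwmodel w x (y *\<^sub>R v) + q v / 2 * (norm (y *\<^sub>R v))\<^sup>2"
proof -
  define Q where "Q y = q v / 2 * (norm (y *\<^sub>R v))\<^sup>2" for y
  \<comment> \<open>\<open>r\<close> is the constant by which the line objective differs from the model.\<close>
  have cancel: "a + ereal (r + s) \<le> b + ereal (r + s') \<Longrightarrow> a + ereal s \<le> b + ereal s'"
    for a b :: ereal and r s s'
    by (cases a; cases b) auto
  have "line_obj f g A w q x v z \<le> line_obj f g A w q x v y" for y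
    using min by (auto simp: is_arg_min_linorder)
  then have *: "wmodel f g A w x (z *\<^sub>R v) + ereal (Q z)
      \<le> wmodel f g A w x (y *\<^sub>R v) + ereal (Q y)" for y
    unfolding line_obj_eq[OF x diff] Q_def
    by (auto simp: power_mult_distrib mult_ac dest: cancel)
  have "wmodel f g A w x (z *\<^sub>R v) + ereal (Q z)
      \<le> wmodel f g A w x (t *\<^sub>R z *\<^sub>R v) + ereal (t\<^sup>2 * Q z)" for t
    using *[of "t * z"] by (simp add: Q_def power_mult_distrib mult_ac)
  note prox = proximal_step[OF x w this]
  show dom: "x + z *\<^sub>R v \<in> comp_dom g A"
    by (rule prox)
  show "rwmodel w x (z *\<^sub>R v) \<le> - q v * (norm (z *\<^sub>R v))\<^sup>2"
    using prox(2) by (simp add: Q_def)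
  show "rwmodel w x (z *\<^sub>R v) + q v / 2 * (norm (z *\<^sub>R v))\<^sup>2
        \<le> rwmodel w x (y *\<^sub>R v) + q v / 2 * (norm (y *\<^sub>R v))\<^sup>2"
    if "x + y *\<^sub>R v \<in> comp_dom g A"
    using *[of y] wmodel_eq_rwmodel[OF x dom, of w] wmodel_eq_rwmodel[OF x that, of w]
    by (simp add: Q_def)
qed

text \<open>The inexactness criterion concerns the models along \<open>v\<close> and \<open>u\<close> separately, and the
  sum of these does not bound the model of \<open>z1 v + z2 u\<close>.  It does bound the model of the
  midpoint, by convexity, which is why the search direction carries the factor \<open>1 / 2\<close>.\<close>
lemma inexact_subspace_step:
  assumes x: "x \<in> comp_dom g A" and diff: "\<And>i. f i differentiable (at x)"
    and a: "\<And>i. 0 < a $ i"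
    and step: "inexact_subspace f g A \<delta> q a x v u l z1 z2"
  defines "w \<equiv> vec_div l a" and "d \<equiv> (1 / 2) *\<^sub>R (z1 *\<^sub>R v + z2 *\<^sub>R u)"
  shows "x + d \<in> comp_dom g A"
    and "rmodel i x d
      \<le> a $ i * ((1 - \<delta>) * (rwmodel w x (z1 *\<^sub>R v) + rwmodel w x (z2 *\<^sub>R u))) / 2"
proof -
  have w: "0 \<le> w $ i" for i
    using step a[of i] by (simp add: inexact_subspace_def w_def vec_div_def unit_simplex_def)
  have min: "is_arg_min (line_obj f g A w q x v) (\<lambda>_. True) z1"
      "is_arg_min (line_obj f g A w q x u) (\<lambda>_. True) z2"
    using step by (auto simp: inexact_subspace_def w_def)
  note dom = line_min(1)[OF x diff w min(1)] line_min(1)[OF x diff w min(2)]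
  show "x + d \<in> comp_dom g A"
    unfolding d_def by (rule rmodel_midpoint_le(1)[OF dom])
  define s where "s i = rmodel i x (z1 *\<^sub>R v) + rmodel i x (z2 *\<^sub>R u)" for i
  have pt: "A *v x + z *\<^sub>R (A *v y) = A *v (x + z *\<^sub>R y)" for z y
    by (simp add: matrix_vector_right_distrib matrix_vector_mult_scaleR)
  have two: "2 * ereal r = ereal (2 * r)" for r
    by (metis numeral_eq_ereal times_ereal.simps(1))
  let ?D = "\<lambda>i. (ereal (grad (f i) x \<bullet> (z1 *\<^sub>R v + z2 *\<^sub>R u)) + g i (A *v x + z1 *\<^sub>R (A *v v))
      + g i (A *v x + z2 *\<^sub>R (A *v u)) - 2 * g i (A *v x)) / ereal (a $ i)"
  have D: "?D i = ereal (s i / a $ i)" for i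
    using a[of i] unfolding pt g_eq_G[OF x] g_eq_G[OF dom(1)] g_eq_G[OF dom(2)]
    by (simp add: two s_def rmodel_def inner_add_right algebra_simps)
  have "?D i \<le> (MAX i. ?D i)"
    by (intro Max_ge) auto
  also have "\<dots> \<le> ereal (1 - \<delta>) * (ereal (wgrad f w x \<bullet> (z1 *\<^sub>R v + z2 *\<^sub>R u))
      + wsum g w (A *v x + z1 *\<^sub>R (A *v v)) + wsum g w (A *v x + z2 *\<^sub>R (A *v u))
      - 2 * wsum g w (A *v x))"
    using step by (simp add: inexact_subspace_def w_def Let_def)
  also have "\<dots> = ereal ((1 - \<delta>) * (rwmodel w x (z1 *\<^sub>R v) + rwmodel w x (z2 *\<^sub>R u)))"
    unfolding pt wsum_eq[OF x] wsum_eq[OF dom(1)] wsum_eq[OF dom(2)] rwmodel_eq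
    by (simp add: two inner_add_right algebra_simps)
  finally have "s i \<le> a $ i * ((1 - \<delta>) * (rwmodel w x (z1 *\<^sub>R v) + rwmodel w x (z2 *\<^sub>R u)))"
    using a[of i] unfolding D by (simp add: field_simps)
  then show "rmodel i x d
      \<le> a $ i * ((1 - \<delta>) * (rwmodel w x (z1 *\<^sub>R v) + rwmodel w x (z2 *\<^sub>R u))) / 2"
    using rmodel_midpoint_le(2)[OF dom, of i] unfolding d_def s_def by simp
qed

section \<open>Line search\<close>

lemma comp_obj_eq: "x \<in> comp_dom g A \<Longrightarrow> comp_obj f g A i x = ereal (f i x + G i x)"
  by (simp add: comp_obj_def g_eq_G)

text \<open>Smoothness costs at most \<open>L t\<^sup>2 \<parallel>d\<parallel>\<^sup>2 / 2\<close> over the model.  For small \<open>t\<close> this is covered by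
  the share \<open>1 - \<sigma>\<close> of the decrease \<open>t \<beta> \<parallel>d\<parallel>\<^sup>2\<close> that the Armijo condition does not
  claim.\<close>
lemma armijo_if_small:
  assumes x: "x \<in> comp_dom g A" and d: "x + d \<in> comp_dom g A"
    and descent: "rmodel i x d \<le> - \<beta> * (norm d)\<^sup>2"
    and smooth: "L_smooth L (f i)"
    and "\<sigma> \<le> 1" "0 < t" "t \<le> 1" "L * t \<le> 2 * (1 - \<sigma>) * \<beta>"
  shows "comp_obj f g A i (x + t *\<^sub>R d) - comp_obj f g A i x \<le> ereal (\<sigma> * t) * model f g A i x d"
proof -
  have t: "x + t *\<^sub>R d \<in> comp_dom g A" "rmodel i x (t *\<^sub>R d) \<le> t * rmodel i x d"
    using rmodel_scaleR_le[OF x d] assms by auto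
  have "f i (x + t *\<^sub>R d) \<le> f i x + grad (f i) x \<bullet> (t *\<^sub>R d) + L / 2 * (norm (t *\<^sub>R d))\<^sup>2"
    using smooth[unfolded L_smooth_def, rule_format, where x = x and y = "x + t *\<^sub>R d"]
    by simp
  then have "f i (x + t *\<^sub>R d) + G i (x + t *\<^sub>R d) - (f i x + G i x)
      \<le> t * rmodel i x d + (L * t) * (t * (norm d)\<^sup>2 / 2)"
    using t(2) by (simp add: rmodel_def power_mult_distrib power2_eq_square mult_ac)
  also have "\<dots> \<le> t * rmodel i x d + (2 * (1 - \<sigma>) * \<beta>) * (t * (norm d)\<^sup>2 / 2)"
    using assms by (intro add_left_mono mult_right_mono) auto
  also have "\<dots> = t * rmodel i x d - t * (1 - \<sigma>) * (- \<beta> * (norm d)\<^sup>2)"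
    by (simp add: field_simps)
  also have "\<dots> \<le> t * rmodel i x d - t * (1 - \<sigma>) * rmodel i x d"
    using assms by (intro diff_left_mono mult_left_mono) auto
  also have "\<dots> = \<sigma> * t * rmodel i x d"
    by (simp add: algebra_simps)
  finally show ?thesis
    by (simp add: comp_obj_eq[OF x] comp_obj_eq[OF t(1)] model_eq_rmodel[OF x d])
qed

text \<open>Either \<open>t = 1\<close>, or the step \<open>t / \<gamma>\<close> was rejected and hence violates the smallness
  condition of \<open>armijo_if_small\<close> for some \<open>i\<close>.  A rejection implies \<open>L i > 0\<close>; if no \<open>L i\<close> is
  positive then \<open>t = 1\<close>, and the quotient in the bound is at most \<open>0\<close> (with value \<open>0\<close> for the
  division by zero).\<close>
lemma line_search_ge:
  assumes x: "x \<in> comp_dom g A" and d: "x + d \<in> comp_dom g A"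
    and descent: "\<And>i. rmodel i x d \<le> - \<beta> * (norm d)\<^sup>2"
    and smooth: "\<And>i. L_smooth (L i) (f i)"
    and \<beta>: "0 < \<beta>" and par: "\<sigma> < 1" "0 < \<gamma>" "\<gamma> < 1"
    and ls: "line_search f g A \<sigma> \<gamma> x d t"
  shows "0 < t" and "min (2 * \<gamma> * (1 - \<sigma>) * \<beta> / (MAX i. L i)) 1 \<le> t"
proof -
  obtain j where j: "t = \<gamma> ^ j"
    using ls by (auto simp: line_search_def step_sizes_def)
  with par show "0 < t" by simp
  show "min (2 * \<gamma> * (1 - \<sigma>) * \<beta> / (MAX i. L i)) 1 \<le> t"
  proof (cases j)
    case 0
    then show ?thesis using j by simp
  next
    case (Suc k)
    have "\<gamma> ^ k \<notin> step_sizes f g A \<sigma> \<gamma> x d"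
      using ls j Suc par unfolding line_search_def by (force simp: not_le)
    then obtain i where i: "\<not> comp_obj f g A i (x + \<gamma> ^ k *\<^sub>R d) - comp_obj f g A i x
        \<le> ereal (\<sigma> * \<gamma> ^ k) * model f g A i x d"
      by (auto simp: step_sizes_def)
    have large: "2 * (1 - \<sigma>) * \<beta> < L i * \<gamma> ^ k"
      using armijo_if_small[OF x d descent smooth, of \<sigma> "\<gamma> ^ k" i] i par
      by (force simp: power_le_one)
    have "L i \<le> (MAX i. L i)" by simp
    then have "L i * \<gamma> ^ k \<le> (MAX i. L i) * \<gamma> ^ k"
      using par by (intro mult_right_mono) auto
    with large have *: "2 * (1 - \<sigma>) * \<beta> < (MAX i. L i) * \<gamma> ^ k" by simp
    have "0 < 2 * (1 - \<sigma>) * \<beta>" using \<beta> par by simp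
    with * have "0 < (MAX i. L i) * \<gamma> ^ k" by linarith
    then have "0 < (MAX i. L i)"
      using par by (simp add: zero_less_mult_iff)
    moreover have "\<gamma> * (2 * (1 - \<sigma>) * \<beta>) \<le> \<gamma> * ((MAX i. L i) * \<gamma> ^ k)"
      using * par by (intro mult_left_mono) auto
    ultimately have "2 * \<gamma> * (1 - \<sigma>) * \<beta> / (MAX i. L i) \<le> t"
      unfolding j Suc by (simp add: pos_divide_le_eq mult_ac)
    then show ?thesis by simp
  qed
qed

text \<open>An accepted step stays in the effective domain, because the model of \<open>d\<close> is finite.\<close>
lemma line_search_decrease:
  assumes x: "x \<in> comp_dom g A" and d: "x + d \<in> comp_dom g A"
    and ls: "line_search f g A \<sigma> \<gamma> x d t"
  shows "x + t *\<^sub>R d \<in> comp_dom g A"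
    and "comp_obj f g A i (x + t *\<^sub>R d) \<le> comp_obj f g A i x + ereal (\<sigma> * t * rmodel i x d)"
proof -
  have "comp_obj f g A i (x + t *\<^sub>R d) - comp_obj f g A i x
      \<le> ereal (\<sigma> * t) * model f g A i x d" for i
    using ls by (auto simp: line_search_def step_sizes_def)
  then have le: "comp_obj f g A i (x + t *\<^sub>R d)
      \<le> comp_obj f g A i x + ereal (\<sigma> * t * rmodel i x d)" for i
    unfolding model_eq_rmodel[OF x d] comp_obj_eq[OF x]
    by (simp add: ereal_minus_le add.commute)
  then show "comp_obj f g A i (x + t *\<^sub>R d) \<le> comp_obj f g A i x + ereal (\<sigma> * t * rmodel i x d)" .
  show "x + t *\<^sub>R d \<in> comp_dom g A"
    unfolding comp_dom_iff
  proof
    fix i show "g i (A *v (x + t *\<^sub>R d)) \<noteq> \<infinity>"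
      using le[of i] unfolding comp_obj_eq[OF x] by (auto simp: comp_obj_def)
  qed
qed

section \<open>Decrease of the merit function\<close>

lemma merit_nonneg:
  assumes x: "x \<in> comp_dom g A"
  shows "0 \<le> merit f g A x"
proof -
  have "0 = (MIN i. comp_obj f g A i x - comp_obj f g A i x)"
    by (simp add: comp_obj_eq[OF x] flip: zero_ereal_def)
  also have "\<dots> \<le> merit f g A x"
    unfolding merit_def by (rule SUP_upper) simp
  finally show ?thesis .
qed

text \<open>Each difference \<open>F\<^sub>i(x') - F\<^sub>i(y)\<close> is smaller than \<open>F\<^sub>i(x) - F\<^sub>i(y)\<close> by at least \<open>s\<close>, uniformly in \<open>i\<close>
  and \<open>y\<close>, so the same holds after taking minima and suprema.\<close>
lemma merit_decrease:
  assumes "\<And>i. comp_obj f g A i x' \<le> comp_obj f g A i x - ereal s"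
  shows "merit f g A x' \<le> merit f g A x - ereal s"
proof -
  have shift: "b - r + ereal s \<le> a - r" if "b \<le> a - ereal s" for a b r :: ereal
    using that by (cases a; cases b; cases r) auto
  have "(MIN i. comp_obj f g A i x' - comp_obj f g A i y) + ereal s \<le> merit f g A x" for y
  proof -
    have "(MIN i. comp_obj f g A i x' - comp_obj f g A i y) + ereal s
        \<le> comp_obj f g A i x - comp_obj f g A i y" for i
    proof -
      have "(MIN i. comp_obj f g A i x' - comp_obj f g A i y) + ereal s
          \<le> comp_obj f g A i x' - comp_obj f g A i y + ereal s"
        by (intro add_right_mono Min_le) auto
      also have "\<dots> \<le> comp_obj f g A i x - comp_obj f g A i y"
        by (rule shift[OF assms])
      finally show ?thesis .
    qed
    then have "(MIN i. comp_obj f g A i x' - comp_obj f g A i y) + ereal s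
        \<le> (MIN i. comp_obj f g A i x - comp_obj f g A i y)"
      by (intro Min.boundedI) auto
    also have "\<dots> \<le> merit f g A x"
      unfolding merit_def by (rule SUP_upper) simp
    finally show ?thesis .
  qed
  then show ?thesis
    unfolding merit_def[of f g A x'] by (intro SUP_least) (simp add: ereal_le_minus)
qed

text \<open>\<open>C\<close> is the quality of the direction relative to the model value \<open>W\<close>, and the error
  bound enters as \<open>W \<le> - merit x / \<kappa>\<close>; the merit is finite because the error bound is.
  Only the product of \<open>C\<close> and the step size matters, so that a loss in one can be offset by
  the other.\<close>
lemma merit_contraction:
  assumes x: "x \<in> comp_dom g A" and d: "x + d \<in> comp_dom g A"
    and ls: "line_search f g A \<sigma> \<gamma> x d t" and t: "0 \<le> t"
    and descent: "\<And>i. rmodel i x d \<le> b * (C * W)"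
    and bound: "merit f g A x \<le> ereal (- \<kappa> * W)"
    and \<eta>: "\<eta> \<le> t * C" and pos: "0 < \<kappa>" "0 \<le> \<sigma>" "0 \<le> b" "0 \<le> C"
  shows "x + t *\<^sub>R d \<in> comp_dom g A"
    and "merit f g A (x + t *\<^sub>R d) \<le> ereal (1 - \<sigma> * \<eta> * b / \<kappa>) * merit f g A x"
proof -
  show "x + t *\<^sub>R d \<in> comp_dom g A"
    by (rule line_search_decrease(1)[OF x d ls])
  obtain m where m: "merit f g A x = ereal m" "0 \<le> m"
    using merit_nonneg[OF x] bound by (cases "merit f g A x") auto
  have W: "W \<le> - (m / \<kappa>)"
    using bound pos by (simp add: m field_simps)
  have decrease: "\<sigma> * t * rmodel i x d \<le> - (\<sigma> * \<eta> * b / \<kappa> * m)" for i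
  proof -
    have "\<sigma> * t * rmodel i x d \<le> \<sigma> * t * (b * (C * W))"
      using descent t pos by (intro mult_left_mono) auto
    also have "\<dots> = (\<sigma> * b * (t * C)) * W"
      by simp
    also have "\<dots> \<le> (\<sigma> * b * (t * C)) * - (m / \<kappa>)"
      using W t pos by (intro mult_left_mono) auto
    also have "\<dots> = (\<sigma> * b * m / \<kappa>) * - (t * C)"
      by simp
    also have "\<dots> \<le> (\<sigma> * b * m / \<kappa>) * - \<eta>"
      using \<eta> m pos by (intro mult_left_mono) auto
    finally show ?thesis by (simp add: mult_ac)
  qed
  have "comp_obj f g A i (x + t *\<^sub>R d) \<le> comp_obj f g A i x - ereal (\<sigma> * \<eta> * b / \<kappa> * m)" for i
    using line_search_decrease(2)[OF x d ls, of i] decrease[of i]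
    unfolding comp_obj_eq[OF x] by (auto elim!: order_trans)
  then have "merit f g A (x + t *\<^sub>R d) \<le> merit f g A x - ereal (\<sigma> * \<eta> * b / \<kappa> * m)"
    by (rule merit_decrease)
  then show "merit f g A (x + t *\<^sub>R d) \<le> ereal (1 - \<sigma> * \<eta> * b / \<kappa>) * merit f g A x"
    by (simp add: m left_diff_distrib)
qed

section \<open>Decrease along the subspace direction\<close>

text \<open>Let \<open>p1\<close>, \<open>p2\<close> be the weighted models of the two line steps; the model of \<open>d\<close> is at
  most \<open>b (1 - \<delta>) (p1 + p2) / 2\<close>.  Bounding \<open>p1\<close> and \<open>p2\<close> by the quadratic decrease of
  proximal steps gives the first estimate, which drives the line search.  For the second,
  discard \<open>p2 \<le> 0\<close> and compare the minimal value along \<open>v\<close> with the value at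
  \<open>\<mu> v\<close>.  There the model is at most \<open>\<mu> r W\<close> with \<open>r = e b / B\<close>, where the quotient
  \<open>b / B\<close> accounts for the change from the preconditioned to the subspace scaling, and the
  quadratic term is at most \<open>- (c2 / (2 c3)) \<mu>\<^sup>2 W\<close>.\<close>
lemma subspace_direction:
  assumes x: "x \<in> comp_dom g A" and diff: "\<And>i. f i differentiable (at x)"
    and a: "\<And>i. b \<le> a $ i" "\<And>i. a $ i \<le> B" and b: "0 < b"
    and step: "inexact_subspace f g A \<delta> q a x v u l z1 z2"
    and q: "\<And>y. c1 \<le> q y" "\<And>y. q y \<le> c2" and c: "0 < c1" "0 < c3" "0 \<le> e" "\<delta> \<le> 1"
    and v: "x + v \<in> comp_dom g A" "\<And>i. rmodel i x v \<le> b * (e * W)" "W \<le> - c3 * (norm v)\<^sup>2"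
  defines "d \<equiv> (1 / 2) *\<^sub>R (z1 *\<^sub>R v + z2 *\<^sub>R u)"
  shows "rmodel i x d \<le> - ((1 - \<delta>) * c1 * b) * (norm d)\<^sup>2"
    and "rmodel i x d \<le> b * ((1 - \<delta>) * e * b / (4 * B) * min (e * c3 * b / (c2 * B)) 1 * W)"
proof -
  have a0: "0 < a $ i" for i
    using a(1)[of i] b by linarith
  define w where "w = vec_div l a"
  have l: "l \<in> unit_simplex"
    and min: "is_arg_min (line_obj f g A w q x v) (\<lambda>_. True) z1"
      "is_arg_min (line_obj f g A w q x u) (\<lambda>_. True) z2"
    using step by (auto simp: inexact_subspace_def w_def)
  have w: "0 \<le> w $ i" for i
    using l a0[of i] by (simp add: w_def vec_div_def unit_simplex_def)
  have B: "0 < B" "b \<le> B" and c2: "0 < c2"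
    using a0[of undefined] a[of undefined] q[of 0] c by linarith+
  have "c3 * (norm v)\<^sup>2 \<ge> 0"
    using c by simp
  with v(3) have W: "W \<le> 0" by linarith

  define p1 where "p1 = rwmodel w x (z1 *\<^sub>R v)"
  define p2 where "p2 = rwmodel w x (z2 *\<^sub>R u)"
  have p: "p1 \<le> - c1 * (norm (z1 *\<^sub>R v))\<^sup>2" "p2 \<le> - c1 * (norm (z2 *\<^sub>R u))\<^sup>2"
    using line_min(2)[OF x diff w min(1)] line_min(2)[OF x diff w min(2)]
      mult_right_mono[OF q(1)[of v], of "(norm (z1 *\<^sub>R v))\<^sup>2"]
      mult_right_mono[OF q(1)[of u], of "(norm (z2 *\<^sub>R u))\<^sup>2"]
    unfolding p1_def p2_def by simp_all
  have "0 \<le> c1 * y\<^sup>2" for y :: real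
    using c by simp
  then have p1: "p1 \<le> 0" and p2: "p2 \<le> 0"
    using p by (smt (verit) mult_minus_left)+
  have "rmodel i x d \<le> a $ i * ((1 - \<delta>) * (p1 + p2)) / 2"
    using inexact_subspace_step(2)[OF x diff a0 step] unfolding d_def p1_def p2_def w_def by simp
  also have "\<dots> \<le> b * ((1 - \<delta>) * (p1 + p2)) / 2"
    using a(1)[of i] p1 p2 c
    by (intro divide_right_mono mult_right_mono_neg) (auto simp: mult_nonneg_nonpos)
  finally have main: "rmodel i x d \<le> b * ((1 - \<delta>) * (p1 + p2)) / 2" .
  have mono: "b * ((1 - \<delta>) * s) / 2 \<le> b * ((1 - \<delta>) * s') / 2" if "s \<le> s'" for s s'
    using that b c by (intro divide_right_mono mult_left_mono) auto

  \<comment> \<open>By the parallelogram identity, the two quadratic decreases add up to one along \<open>d\<close>.\<close>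
  have norm_d: "(norm d)\<^sup>2 = (norm (z1 *\<^sub>R v + z2 *\<^sub>R u))\<^sup>2 / 4"
    by (simp add: d_def power_divide)
  have "(norm (z1 *\<^sub>R v + z2 *\<^sub>R u))\<^sup>2 + (norm (z1 *\<^sub>R v - z2 *\<^sub>R u))\<^sup>2
      = 2 * ((norm (z1 *\<^sub>R v))\<^sup>2 + (norm (z2 *\<^sub>R u))\<^sup>2)"
    unfolding power2_norm_eq_inner by (simp add: algebra_simps)
  moreover have quarter: "2 * (n / 4) \<le> r" if "n + m = 2 * r" "0 \<le> m" for n m r :: real
    using that by simp
  ultimately have "2 * (norm d)\<^sup>2 \<le> (norm (z1 *\<^sub>R v))\<^sup>2 + (norm (z2 *\<^sub>R u))\<^sup>2"
    using zero_le_power2[of "norm (z1 *\<^sub>R v - z2 *\<^sub>R u)"] unfolding norm_d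
    by (metis (no_types, opaque_lifting) quarter)
  then have "c1 * (2 * (norm d)\<^sup>2) \<le> c1 * ((norm (z1 *\<^sub>R v))\<^sup>2 + (norm (z2 *\<^sub>R u))\<^sup>2)"
    using c by (intro mult_left_mono) auto
  then have "p1 + p2 \<le> - 2 * c1 * (norm d)\<^sup>2"
    using p by (simp add: algebra_simps)
  from mono[OF this] main show "rmodel i x d \<le> - ((1 - \<delta>) * c1 * b) * (norm d)\<^sup>2"
    by (simp add: mult_ac)

  define r where "r = e * b / B"
  \<comment> \<open>\<open>r * c3 / c2\<close> minimizes the bound \<open>\<mu> r W - (c2 / (2 c3)) \<mu>\<^sup>2 W\<close>; it is truncated
    because convexity only bounds the model on the segment \<open>[0, 1]\<close>.\<close>
  define \<mu> where "\<mu> = min (r * c3 / c2) 1"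
  have r: "0 \<le> r" and \<mu>: "0 \<le> \<mu>" "\<mu> \<le> 1" "c2 * \<mu> \<le> r * c3"
    using b B c c2 by (auto simp: r_def \<mu>_def min_def field_simps)
  have "rmodel i x v / a $ i \<le> r * W" for i
  proof -
    have "rmodel i x v / a $ i \<le> b * (e * W) / a $ i"
      using v(2) a0[of i] by (simp add: divide_right_mono)
    also have "\<dots> \<le> b * (e * W) / B"
      using a(2)[of i] a0[of i] W b c by (intro divide_left_mono_neg) (auto simp: mult_nonneg_nonpos)
    finally show ?thesis by (simp add: r_def mult_ac)
  qed
  from unit_simplex_sum_le[OF l this] have "rwmodel w x v \<le> r * W"
    by (simp add: rwmodel_def w_def vec_div_def)
  then have "rwmodel w x (\<mu> *\<^sub>R v) \<le> \<mu> * (r * W)"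
    using rwmodel_scaleR_le[OF x v(1) \<mu>(1,2) w] mult_left_mono[OF _ \<mu>(1)] by fastforce
  moreover have "q v / 2 * (norm (\<mu> *\<^sub>R v))\<^sup>2 \<le> - \<mu> * (r * W) / 2"
  proof -
    have "c3 * (q v / 2 * (norm (\<mu> *\<^sub>R v))\<^sup>2) = q v * (\<mu>\<^sup>2 / 2 * (c3 * (norm v)\<^sup>2))"
      by (simp add: power_mult_distrib)
    also have "\<dots> \<le> c2 * (\<mu>\<^sup>2 / 2 * (c3 * (norm v)\<^sup>2))"
      using q(2)[of v] c by (intro mult_right_mono) auto
    also have "\<dots> \<le> c2 * (\<mu>\<^sup>2 / 2 * - W)"
      using v(3) c2 by (intro mult_left_mono) auto
    also have "\<dots> = (c2 * \<mu>) * (\<mu> / 2 * - W)"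
      by (simp add: power2_eq_square)
    also have "\<dots> \<le> (r * c3) * (\<mu> / 2 * - W)"
      using \<mu> W by (intro mult_right_mono) (auto simp: mult_nonneg_nonpos)
    also have "\<dots> = c3 * (- \<mu> * (r * W) / 2)"
      by simp
    finally show ?thesis
      using c by (simp only: mult_le_cancel_left_pos)
  qed
  moreover have "p1 \<le> rwmodel w x (\<mu> *\<^sub>R v) + q v / 2 * (norm (\<mu> *\<^sub>R v))\<^sup>2"
  proof -
    have "0 \<le> q v / 2 * (norm (z1 *\<^sub>R v))\<^sup>2"
      using q(1)[of v] c by simp
    with line_min(3)[OF x diff w min(1) rmodel_scaleR_le(1)[OF x v(1) \<mu>(1,2)]]
    show ?thesis unfolding p1_def by linarith
  qed
  ultimately have "p1 + p2 \<le> \<mu> * (r * W) / 2"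
    using p2 by simp
  from mono[OF this] main have "rmodel i x d \<le> b * ((1 - \<delta>) * (\<mu> * (r * W) / 2)) / 2"
    by simp
  also have "\<dots> = b * ((1 - \<delta>) * e * b / (4 * B) * \<mu> * W)"
    by (simp add: r_def)
  also have "\<mu> = min (e * c3 * b / (c2 * B)) 1"
    by (simp add: \<mu>_def r_def mult_ac)
  finally show "rmodel i x d
      \<le> b * ((1 - \<delta>) * e * b / (4 * B) * min (e * c3 * b / (c2 * B)) 1 * W)" .
qed

end

section \<open>Linear convergence\<close>

text \<open>The left-hand side is \<open>t\<^sub>m\<^sub>i\<^sub>n c\<close>, the right-hand side the lower bound of step size times
  quality for the initial direction (\<open>p = 1 - \<delta>\<close>, \<open>e = 1 - \<epsilon>\<close>, and
  \<open>K = 2 \<gamma> (1 - \<sigma>) \<alpha>\<^sub>m\<^sub>i\<^sub>n / L\<^sub>m\<^sub>a\<^sub>x\<close>).  If the step size bound on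
  the right is \<open>1\<close>, then \<open>c \<le> e\<close> suffices.  Otherwise use the bound of \<open>c\<close> that contains
  \<open>c3 / c2\<close>: it supplies the factor \<open>c3\<close>, and \<open>c1 / c2 \<le> 1\<close> cancels \<open>c1\<close>.\<close>
lemma initial_rate:
  fixes K p e b B c1 c2 c3 :: real
  assumes "0 < p" "p \<le> 1" "0 < e" "e \<le> 1" "0 < b" "b \<le> B" "0 < c1" "c1 \<le> c2" "0 < c3"
    and K: "0 \<le> K"
  shows "min (K * (p * c1)) 1 * (p * e * b / (4 * B) * min (e * c3 * b / (c2 * B)) 1)
    \<le> min (K * (e * c3)) 1 * e"
proof -
  define \<rho> where "\<rho> = b / B"
  define c where "c = p * e * \<rho> / 4 * min (e * c3 * \<rho> / c2) 1"
  have \<rho>: "0 \<le> \<rho>" "\<rho> \<le> 1"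
    using assms by (auto simp: \<rho>_def)
  have c2: "0 < c2"
    using assms by linarith
  have pr: "p * \<rho> / 4 \<le> 1" "0 \<le> p * \<rho> / 4"
    using mult_le_one[of p \<rho>] \<rho> assms by auto
  have c_le: "c \<le> e" and c0: "0 \<le> c"
  proof -
    have "c \<le> (p * \<rho> / 4) * e * 1"
      unfolding c_def using assms \<rho> pr by (intro mult_mono) (auto simp: c2)
    also have "\<dots> \<le> 1 * e * 1"
      using pr assms by (intro mult_right_mono) auto
    finally show "c \<le> e" by simp
    show "0 \<le> c"
      unfolding c_def using assms \<rho> c2 by simp
  qed
  have "K * (p * c1) * c \<le> K * (e * c3) * e"
  proof -
    have "p * c1 * c \<le> p * c1 * (p * e * \<rho> / 4 * (e * c3 * \<rho> / c2))"
      unfolding c_def using assms \<rho> by (intro mult_left_mono) auto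
    also have "\<dots> = (p * \<rho> / 4) * (p * \<rho>) * (c1 / c2) * (e * c3 * e)"
      by (simp add: mult_ac)
    also have "\<dots> \<le> 1 * 1 * 1 * (e * c3 * e)"
      using pr assms c2 \<rho> by (intro mult_right_mono mult_mono) (auto simp: mult_le_one)
    finally show ?thesis
      using mult_left_mono[OF _ K] by (fastforce simp: mult.assoc)
  qed
  moreover have "min (K * (p * c1)) 1 * c \<le> K * (p * c1) * c"
    using c0 by (intro mult_right_mono) auto
  moreover have "min (K * (p * c1)) 1 * c \<le> 1 * c"
    using c0 by (intro mult_right_mono) auto
  ultimately have "min (K * (p * c1)) 1 * c \<le> min (K * (e * c3)) 1 * e"
    using c_le by (auto simp: min_def)
  then show ?thesis
    unfolding c_def \<rho>_def by (simp add: mult.commute[of c2] mult.commute[of 4])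
qed

theorem theorem5p2:
  fixes f :: "'m::finite \<Rightarrow> real^'n \<Rightarrow> real"
    and g :: "'m \<Rightarrow> real^'p \<Rightarrow> ereal"
    and A :: "real^'n^'p"
    and L :: "'m \<Rightarrow> real"
    and \<epsilon> \<delta> c\<^sub>1 c\<^sub>2 c\<^sub>3 c\<^sub>4 \<sigma> \<gamma> \<alpha>\<^sub>m\<^sub>i\<^sub>n \<alpha>\<^sub>m\<^sub>a\<^sub>x \<kappa> c t\<^sub>m\<^sub>i\<^sub>n L\<^sub>m\<^sub>a\<^sub>x :: real
    and N :: enat
    and x\<^sub>_\<^sub>1 :: "real^'n"
    and x :: "nat \<Rightarrow> real^'n"
  assumes "\<And>i. continuously_differentiable (f i)"
    and "\<And>i. proper_fun (g i) \<and> convex_fun (g i) \<and> lsc_fun (g i)"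
    and "0 \<le> \<epsilon>" "\<epsilon> < 1" "0 \<le> \<delta>" "\<delta> < 1"
    and "0 < c\<^sub>1" "c\<^sub>1 \<le> c\<^sub>2" "0 < c\<^sub>3" "c\<^sub>3 \<le> c\<^sub>4"
    and "0 < \<sigma>" "\<sigma> < 1" "0 < \<gamma>" "\<gamma> < 1"
    and "0 < \<alpha>\<^sub>m\<^sub>i\<^sub>n" "\<alpha>\<^sub>m\<^sub>i\<^sub>n \<le> \<alpha>\<^sub>m\<^sub>a\<^sub>x"
    and "\<And>i. L_smooth (L i) (f i)"
    and "0 < \<kappa>"
    and "error_bound f g A \<epsilon> c\<^sub>3 c\<^sub>4 \<alpha>\<^sub>m\<^sub>i\<^sub>n \<alpha>\<^sub>m\<^sub>a\<^sub>x \<kappa>"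
    and "ispbb_run f g A \<epsilon> \<delta> c\<^sub>1 c\<^sub>2 c\<^sub>3 c\<^sub>4 \<sigma> \<gamma> \<alpha>\<^sub>m\<^sub>i\<^sub>n \<alpha>\<^sub>m\<^sub>a\<^sub>x N x\<^sub>_\<^sub>1 x"
    and "L\<^sub>m\<^sub>a\<^sub>x = (MAX i. L i)"
    and "c = (1 - \<delta>) * (1 - \<epsilon>) * \<alpha>\<^sub>m\<^sub>i\<^sub>n / (4 * \<alpha>\<^sub>m\<^sub>a\<^sub>x)
               * min ((1 - \<epsilon>) * c\<^sub>3 * \<alpha>\<^sub>m\<^sub>i\<^sub>n / (c\<^sub>2 * \<alpha>\<^sub>m\<^sub>a\<^sub>x)) 1"
    and "t\<^sub>m\<^sub>i\<^sub>n = min (2 * \<gamma> * (1 - \<sigma>) * (1 - \<delta>) * c\<^sub>1 * \<alpha>\<^sub>m\<^sub>i\<^sub>n / L\<^sub>m\<^sub>a\<^sub>x) 1"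
  shows "\<forall>k. enat k < N \<longrightarrow>
           merit f g A (x (Suc k))
             \<le> ereal (1 - \<sigma> * t\<^sub>m\<^sub>i\<^sub>n * c * \<alpha>\<^sub>m\<^sub>i\<^sub>n / \<kappa>) * merit f g A (x k)"
proof -
  note c1 = \<open>0 < c\<^sub>1\<close> and c3 = \<open>0 < c\<^sub>3\<close> and b = \<open>0 < \<alpha>\<^sub>m\<^sub>i\<^sub>n\<close>
  interpret convex_composite f g A
    by unfold_locales (use assms(2) in auto)
  have diff: "f i differentiable (at y)" for i y
    using assms(1) by (simp add: continuously_differentiable_def)
  have c0: "0 \<le> c"
    using assms by simp
  obtain P a' l' v a l d t where start: "x 0 \<in> comp_dom g A" and
    run: "\<And>k xprev. enat k < N \<Longrightarrow> xprev = (if k = 0 then x\<^sub>_\<^sub>1 else x (k - 1)) \<Longrightarrow>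
      preconditioner c\<^sub>3 c\<^sub>4 (P k) \<and>
      a' k = precond_scaling f \<alpha>\<^sub>m\<^sub>i\<^sub>n \<alpha>\<^sub>m\<^sub>a\<^sub>x (P k) xprev (x k) \<and>
      inexact_pbb f g A \<epsilon> (a' k) (P k) (x k) (l' k) (v k) \<and>
      (if k = 0 then d 0 = v 0 \<and> l 0 = l' 0 \<and> a 0 = a' 0
       else subspace_step f g A \<delta> c\<^sub>1 c\<^sub>2 \<alpha>\<^sub>m\<^sub>i\<^sub>n \<alpha>\<^sub>m\<^sub>a\<^sub>x (P k) (vec_div (l (k - 1)) (a (k - 1)))
              xprev (x k) (v k) (l k) (a k) (d k)) \<and>
      line_search f g A \<sigma> \<gamma> (x k) (d k) (t k) \<and>
      x (Suc k) = x k + t k *\<^sub>R d k"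
    using \<open>ispbb_run f g A \<epsilon> \<delta> c\<^sub>1 c\<^sub>2 c\<^sub>3 c\<^sub>4 \<sigma> \<gamma> \<alpha>\<^sub>m\<^sub>i\<^sub>n \<alpha>\<^sub>m\<^sub>a\<^sub>x N x\<^sub>_\<^sub>1 x\<close>
    unfolding ispbb_run_def Let_def by (elim conjE exE) blast
  define K where "K = 2 * \<gamma> * (1 - \<sigma>) * \<alpha>\<^sub>m\<^sub>i\<^sub>n / (MAX i. L i)"
  have tmin: "t\<^sub>m\<^sub>i\<^sub>n = min (K * ((1 - \<delta>) * c\<^sub>1)) 1"
    using assms(21,23) by (simp add: K_def mult_ac)

  have step: "x (Suc k) \<in> comp_dom g A \<and> merit f g A (x (Suc k))
      \<le> ereal (1 - \<sigma> * (t\<^sub>m\<^sub>i\<^sub>n * c) * \<alpha>\<^sub>m\<^sub>i\<^sub>n / \<kappa>) * merit f g A (x k)"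
    if k: "enat k < N" and x: "x k \<in> comp_dom g A" for k
  proof -
    note run = run[OF k refl]
    have ls: "line_search f g A \<sigma> \<gamma> (x k) (d k) (t k)"
      and x': "x (Suc k) = x k + t k *\<^sub>R d k"
      and P: "preconditioner c\<^sub>3 c\<^sub>4 (P k)"
      and pbb: "inexact_pbb f g A \<epsilon> (a' k) (P k) (x k) (l' k) (v k)"
      using run by auto
    have a': "\<alpha>\<^sub>m\<^sub>i\<^sub>n \<le> a' k $ i" "a' k $ i \<le> \<alpha>\<^sub>m\<^sub>a\<^sub>x" for i
      using run bb_rule_bounds[OF \<open>\<alpha>\<^sub>m\<^sub>i\<^sub>n \<le> \<alpha>\<^sub>m\<^sub>a\<^sub>x\<close>] by (auto simp: precond_scaling_def Let_def)
    have a'0: "0 < a' k $ i" for i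
      using a'(1)[of i] b by linarith
    define W where "W = rwmodel (vec_div (l' k) (a' k)) (x k) (v k)"
    note prox = inexact_pbb_step[OF x a'0 pbb, folded W_def]
    have W: "W \<le> - c\<^sub>3 * (norm (v k))\<^sup>2"
      using prox(2) preconditioner_pnorm_ge[OF P, of "v k"] c3 by simp
    have "0 \<le> c\<^sub>3 * (norm (v k))\<^sup>2"
      using c3 by simp
    with W have W0: "W \<le> 0" by linarith
    have v: "rmodel i (x k) (v k) \<le> \<alpha>\<^sub>m\<^sub>i\<^sub>n * ((1 - \<epsilon>) * W)" for i
    proof -
      have "a' k $ i * ((1 - \<epsilon>) * W) \<le> \<alpha>\<^sub>m\<^sub>i\<^sub>n * ((1 - \<epsilon>) * W)"
        using a'(1) W0 \<open>\<epsilon> < 1\<close> by (intro mult_right_mono_neg) (auto simp: mult_nonneg_nonpos)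
      with prox(3)[of i] show ?thesis by linarith
    qed
    have bound: "merit f g A (x k) \<le> ereal (- \<kappa> * W)"
    proof -
      have "merit f g A (x k) \<le> - (ereal \<kappa> * prox_obj f g A (vec_div (l' k) (a' k)) (P k) (x k) (v k))"
        using \<open>error_bound f g A \<epsilon> c\<^sub>3 c\<^sub>4 \<alpha>\<^sub>m\<^sub>i\<^sub>n \<alpha>\<^sub>m\<^sub>a\<^sub>x \<kappa>\<close> x a' P pbb unfolding error_bound_def by auto
      also have "\<dots> \<le> ereal (- \<kappa> * W)"
        using \<open>0 < \<kappa>\<close> by (simp add: prox(4) W_def)
      finally show ?thesis .
    qed
    have contract: ?thesis
      if "x k + d k \<in> comp_dom g A" "0 < t k" "0 \<le> C" "t\<^sub>m\<^sub>i\<^sub>n * c \<le> t k * C"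
        "\<And>i. rmodel i (x k) (d k) \<le> \<alpha>\<^sub>m\<^sub>i\<^sub>n * (C * W)" for C
      using merit_contraction[OF x that(1) ls _ that(5) bound that(4)] that \<open>0 < \<kappa>\<close> \<open>0 < \<sigma>\<close> b
      unfolding x' by simp
    show ?thesis
    proof (cases "k = 0")
      case True
      then have d: "d k = v k" using run by simp
      have "rmodel i (x k) (d k) \<le> - (\<alpha>\<^sub>m\<^sub>i\<^sub>n * ((1 - \<epsilon>) * c\<^sub>3)) * (norm (d k))\<^sup>2" for i
      proof -
        have "\<alpha>\<^sub>m\<^sub>i\<^sub>n * ((1 - \<epsilon>) * W) \<le> \<alpha>\<^sub>m\<^sub>i\<^sub>n * ((1 - \<epsilon>) * (- c\<^sub>3 * (norm (v k))\<^sup>2))"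
          using W b \<open>\<epsilon> < 1\<close> by (intro mult_left_mono) auto
        with v[of i] show ?thesis unfolding d by simp
      qed
      note t = line_search_ge[OF x prox(1)[folded d] this assms(17) _ \<open>\<sigma> < 1\<close> \<open>0 < \<gamma>\<close> \<open>\<gamma> < 1\<close> ls]
      have t0: "0 < t k" and t: "min (K * ((1 - \<epsilon>) * c\<^sub>3)) 1 \<le> t k"
        using t b c3 \<open>\<epsilon> < 1\<close> by (simp_all add: K_def mult_ac)
      have "t\<^sub>m\<^sub>i\<^sub>n * c \<le> t k * (1 - \<epsilon>)"
      proof (cases "0 \<le> K")
        case True
        have "t\<^sub>m\<^sub>i\<^sub>n * c \<le> min (K * ((1 - \<epsilon>) * c\<^sub>3)) 1 * (1 - \<epsilon>)"
          unfolding tmin assms(22) using assms True by (intro initial_rate) auto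
        also have "\<dots> \<le> t k * (1 - \<epsilon>)"
          using t \<open>\<epsilon> < 1\<close> by (intro mult_right_mono) auto
        finally show ?thesis .
      next
        \<comment> \<open>All \<open>L i\<close> are negative, so \<open>t\<^sub>m\<^sub>i\<^sub>n\<close> is not positive.\<close>
        case False
        then have "K * ((1 - \<delta>) * c\<^sub>1) \<le> 0"
          using c1 \<open>\<delta> < 1\<close> by (intro mult_nonpos_nonneg) auto
        then have "t\<^sub>m\<^sub>i\<^sub>n * c \<le> 0"
          unfolding tmin using c0 by (intro mult_nonpos_nonneg) auto
        also have "0 \<le> t k * (1 - \<epsilon>)"
          using t0 \<open>\<epsilon> < 1\<close> by simp
        finally show ?thesis .
      qed
      then show ?thesis
        using contract[of "1 - \<epsilon>"] prox(1) t0 v \<open>\<epsilon> < 1\<close> unfolding d by simp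
    next
      case False
      let ?w = "vec_div (l (k - 1)) (a (k - 1))"
      obtain h u z1 z2 where
        a: "a k = subspace_scaling f \<alpha>\<^sub>m\<^sub>i\<^sub>n \<alpha>\<^sub>m\<^sub>a\<^sub>x (curv f c\<^sub>1 c\<^sub>2 ?w h (x k)) (x (k - 1)) (x k)"
        and sub: "inexact_subspace f g A \<delta> (curv f c\<^sub>1 c\<^sub>2 ?w h (x k)) (a k) (x k) (v k) u (l k) z1 z2"
        and d: "d k = (1 / 2) *\<^sub>R (z1 *\<^sub>R v k + z2 *\<^sub>R u)"
        using run False unfolding subspace_step_def Let_def by auto
      have a: "\<alpha>\<^sub>m\<^sub>i\<^sub>n \<le> a k $ i" "a k $ i \<le> \<alpha>\<^sub>m\<^sub>a\<^sub>x" for i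
        unfolding a using bb_rule_bounds[OF \<open>\<alpha>\<^sub>m\<^sub>i\<^sub>n \<le> \<alpha>\<^sub>m\<^sub>a\<^sub>x\<close>]
        by (auto simp: subspace_scaling_def Let_def)
      have a0: "0 < a k $ i" for i
        using a(1)[of i] b by linarith
      have q: "c\<^sub>1 \<le> curv f c\<^sub>1 c\<^sub>2 ?w h (x k) y" "curv f c\<^sub>1 c\<^sub>2 ?w h (x k) y \<le> c\<^sub>2" for y
        using bb_rule_bounds[OF \<open>c\<^sub>1 \<le> c\<^sub>2\<close>] by (auto simp: curv_def Let_def)
      have dom: "x k + d k \<in> comp_dom g A"
        unfolding d by (rule inexact_subspace_step(1)[OF x diff a0 sub])
      have \<epsilon>\<delta>: "0 \<le> 1 - \<epsilon>" "\<delta> \<le> 1"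
        using \<open>\<epsilon> < 1\<close> \<open>\<delta> < 1\<close> by auto
      note dir = subspace_direction[OF x diff a b sub q c1 c3 \<epsilon>\<delta> prox(1) v W, folded d]
      have pos: "0 < (1 - \<delta>) * c\<^sub>1 * \<alpha>\<^sub>m\<^sub>i\<^sub>n"
        using c1 b \<open>\<delta> < 1\<close> by simp
      note t = line_search_ge[OF x dom dir(1) assms(17) pos \<open>\<sigma> < 1\<close> \<open>0 < \<gamma>\<close> \<open>\<gamma> < 1\<close> ls]
      have "t\<^sub>m\<^sub>i\<^sub>n \<le> t k"
        using t(2) by (simp add: tmin K_def mult_ac)
      then show ?thesis
        using contract[of c] dom t(1) c0 dir(2) mult_right_mono[OF _ c0]
        unfolding assms(22) by blast
    qed
  qed
  have "x k \<in> comp_dom g A" if "enat k \<le> N" for k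
    using that
  proof (induction k)
    case 0
    show ?case by (rule start)
  next
    case (Suc k)
    then have "enat k < N"
      by (simp add: Suc_ile_eq)
    with Suc show ?case
      using step by (simp add: less_imp_le)
  qed
  then show ?thesis
    using step by (simp add: less_imp_le mult.assoc)
qed

end
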